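(* For every graph $G$ and every integer $k\ge 2$, $$\gamma_{k{\rm rt}}(G)\ge \frac{2k}{k+1}\gamma(G).$$
   Context: All graphs are finite, simple and undirected; $N(v)$ denotes the open neighborhood of $v$, and $[k]=\{1,\dots,k\}$. $\gamma(G)$ is the domination number. A $k$-rainbow total dominating function ($k$RTDF) of $G$ is a function $f:V(G)\to 2^{[k]}$ such that (i) every vertex $v$ with $f(v)=\emptyset$ satisfies $\bigcup_{u\in N(v)}f(u)=[k]$, and (ii) for every vertex $v$ with $f(v)=\{i\}$ for some $i\in[k]$ there is $u\in N(v)$ with $i\in f(u)$. Its weight is $\|f\|=\sum_{v}|f(v)|$ and $\gamma_{k{\rm rt}}(G)$ is the minimum weight of a $k$RTDF of $G$. *)

theory Defs
  imports Complex_Main "Graph_Theory.Pair_Digraph"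
begin

text \<open>
  Finite simple undirected graphs are the instances of \<^locale>\<open>pair_graph\<close>: a finite vertex set
  with a symmetric, irreflexive set of ordered pairs, an edge \<open>uv\<close> being represented by both
  \<open>(u, v)\<close> and \<open>(v, u)\<close>.
\<close>

definition nbhd :: "'a pair_pre_digraph \<Rightarrow> 'a \<Rightarrow> 'a set" where
  "nbhd G v = {u. (v, u) \<in> parcs G}"

definition dominating_set :: "'a pair_pre_digraph \<Rightarrow> 'a set \<Rightarrow> bool" where
  "dominating_set G D \<longleftrightarrow> D \<subseteq> pverts G \<and> (\<forall>v \<in> pverts G - D. nbhd G v \<inter> D \<noteq> {})"

definition domination_number :: "'a pair_pre_digraph \<Rightarrow> nat" where
  "domination_number G = (LEAST n. \<exists>D. dominating_set G D \<and> card D = n)"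

text \<open>
  A function on the vertices is a total function on the type \<open>'a\<close> whose values outside
  \<open>pverts G\<close> are irrelevant: they enter neither the conditions nor the weight.
\<close>

definition k_rtdf :: "nat \<Rightarrow> 'a pair_pre_digraph \<Rightarrow> ('a \<Rightarrow> nat set) \<Rightarrow> bool" where
  "k_rtdf k G f \<longleftrightarrow>
     (\<forall>v \<in> pverts G. f v \<subseteq> {1..k}) \<and>
     (\<forall>v \<in> pverts G. f v = {} \<longrightarrow> (\<Union>u \<in> nbhd G v. f u) = {1..k}) \<and>
     (\<forall>v \<in> pverts G. \<forall>i \<in> {1..k}. f v = {i} \<longrightarrow> (\<exists>u \<in> nbhd G v. i \<in> f u))"

definition weight :: "'a pair_pre_digraph \<Rightarrow> ('a \<Rightarrow> nat set) \<Rightarrow> nat" where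
  "weight G f = (\<Sum>v \<in> pverts G. card (f v))"

definition k_rt_domination_number :: "nat \<Rightarrow> 'a pair_pre_digraph \<Rightarrow> nat" where
  "k_rt_domination_number k G = (LEAST w. \<exists>f. k_rtdf k G f \<and> weight G f = w)"

text \<open>
  Both minima are taken over nonempty sets, so they are attained. For \<open>k \<ge> 2\<close>, assigning
  \<open>{1..k}\<close> to every vertex is always admissible, even when there are isolated vertices.
\<close>

lemma domination_number_attained:
  obtains D where "dominating_set G D" "card D = domination_number G"
proof -
  have "\<exists>D. dominating_set G D \<and> card D = card (pverts G)"
    by (rule exI[of _ "pverts G"]) (simp add: dominating_set_def)
  from LeastI[where P = "\<lambda>n. \<exists>D. dominating_set G D \<and> card D = n", OF this] that
  show thesis by (auto simp: domination_number_def)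
qed

lemma domination_number_le: "dominating_set G D \<Longrightarrow> domination_number G \<le> card D"
  unfolding domination_number_def by (rule Least_le) blast

lemma k_rt_domination_number_attained:
  assumes "k \<ge> 2"
  obtains f where "k_rtdf k G f" "weight G f = k_rt_domination_number k G"
proof -
  have "{1..k} \<noteq> {i}" for i
    using assms by (metis card_atLeastAtMost card.empty card.insert diff_Suc_1 empty_iff
        finite.emptyI not_less_eq_eq numeral_2_eq_2 One_nat_def order_refl)
  then have "k_rtdf k G (\<lambda>_. {1..k})"
    using assms by (auto simp: k_rtdf_def)
  then have "\<exists>f. k_rtdf k G f \<and> weight G f = weight G (\<lambda>_::'a. {1..k})" by blast
  from LeastI[where P = "\<lambda>w. \<exists>f. k_rtdf k G f \<and> weight G f = w", OF this] that
  show thesis by (auto simp: k_rt_domination_number_def)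
qed

lemma k_rt_domination_number_le: "k_rtdf k G f \<Longrightarrow> k_rt_domination_number k G \<le> weight G f"
  unfolding k_rt_domination_number_def by (rule Least_le) blast

end

theory Submission
  imports Defs
begin

text \<open>
  Let \<open>f\<close> be an optimal function, \<open>S\<close> the vertices with one color and \<open>B\<close> those with at least two.
  A vertex of \<open>S\<close> without neighbors in \<open>B\<close> has a neighbor in \<open>S\<close> of its own color, so by Ore's
  argument some \<open>T \<subseteq> S\<close> with \<open>2 |T| \<le> |S|\<close> dominates all these vertices. For every color \<open>i\<close>, the
  union of \<open>B\<close>, \<open>T\<close> and the vertices with \<open>f v = {i}\<close> is then a dominating set. Summing
  the sizes of these \<open>k\<close> sets gives
  \<open>k \<gamma> \<le> k |B| + k |T| + |S - T| \<le> k |B| + (k + 1) |S| / 2 \<le> (k + 1) / 2 * (|S| + 2 |B|)\<close>.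
\<close>

text \<open>For a minimum dominating \<open>T\<close>, the complement \<open>X - T\<close> dominates
  as well: a vertex of \<open>T\<close> without neighbors in \<open>X - T\<close> could be dropped
  from \<open>T\<close>. Minimality then gives \<open>card T \<le> card (X - T)\<close>.\<close>

lemma Ore_half_dominating:
  assumes "finite X" and sym: "sym r" and irr: "irrefl r"
    and total: "\<And>v. v \<in> X \<Longrightarrow> \<exists>u\<in>X. (v, u) \<in> r"
  obtains T where "T \<subseteq> X" "2 * card T \<le> card X" "\<And>v. v \<in> X - T \<Longrightarrow> \<exists>u\<in>T. (v, u) \<in> r"
proof -
  define dom where "dom = (\<lambda>T. T \<subseteq> X \<and> (\<forall>v\<in>X - T. \<exists>u\<in>T. (v, u) \<in> r))"
  have "dom X"
    by (simp add: dom_def)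
  then obtain T where T: "dom T" and min: "\<And>U. dom U \<Longrightarrow> card T \<le> card U"
    using ex_has_least_nat[of dom X card] by blast
  have TX: "T \<subseteq> X" and fin: "finite T"
    using T \<open>finite X\<close> finite_subset by (auto simp: dom_def)
  have "dom (X - T)"
    unfolding dom_def
  proof (intro conjI ballI)
    fix v assume "v \<in> X - (X - T)"
    then have v: "v \<in> T" "v \<in> X"
      by auto
    show "\<exists>u\<in>X - T. (v, u) \<in> r"
    proof (rule ccontr)
      assume none: "\<not> (\<exists>u\<in>X - T. (v, u) \<in> r)"
      \<comment> \<open>By \<open>none\<close>, all neighbors of \<open>v\<close> in
        \<open>X\<close> lie in \<open>T - {v}\<close>, and by symmetry no \<open>w\<close> outside
        \<open>T\<close> relies on \<open>v\<close>.\<close>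
      have "\<exists>u\<in>T - {v}. (w, u) \<in> r" if w: "w \<in> X - (T - {v})" for w
      proof (cases "w = v")
        case True
        obtain u where "u \<in> X" "(v, u) \<in> r"
          using total v by blast
        then show ?thesis
          using none irr True by (auto simp: irrefl_def)
      next
        case False
        then obtain u where "u \<in> T" "(w, u) \<in> r"
          using w T by (auto simp: dom_def)
        moreover from this have "u \<noteq> v"
          using none sym w False by (auto dest: symD)
        ultimately show ?thesis by blast
      qed
      then have "dom (T - {v})"
        using TX by (auto simp: dom_def)
      from min[OF this] show False
        using card_Diff1_less[OF fin v(1)] by simp
    qed
  qed auto
  then have "card T \<le> card X - card T"
    using min[of "X - T"] card_Diff_subset[OF fin TX] by simp
  moreover have "card T \<le> card X"
    using TX \<open>finite X\<close> by (rule card_mono[rotated])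
  ultimately show thesis
    using that[of T] T by (auto simp: dom_def)
qed

text \<open>Clearing the denominator keeps the count within the natural numbers.\<close>

lemma k_rtdf_weight_bound:
  fixes G :: "'a pair_pre_digraph"
  assumes G: "pair_graph G" and "k \<ge> 1" and f: "k_rtdf k G f"
  shows "2 * k * domination_number G \<le> (k + 1) * weight G f"
proof -
  interpret pair_graph G by fact
  define V where "V = pverts G"
  define S where "S = {v \<in> V. card (f v) = 1}"
  define B where "B = {v \<in> V. card (f v) \<ge> 2}"
  define r where "r = {(u, v). (u, v) \<in> parcs G \<and> f u = f v}"
  \<comment> \<open>Ore's argument needs every vertex to have a partner, so it is applied to
    \<open>X\<close>; the vertices of \<open>S - X\<close> get their color from a neighbor in
    \<open>B\<close>.\<close>
  define X where "X = {v \<in> S. \<exists>u\<in>S. (v, u) \<in> r}"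
  have finV: "finite V"
    by (simp add: V_def)
  then have finS: "finite S" and finB: "finite B"
    by (auto simp: S_def B_def)
  have finX: "finite X"
    using finS by (simp add: X_def)
  have col: "f v \<subseteq> {1..k}" if "v \<in> V" for v
    using f that by (simp add: k_rtdf_def V_def)
  have fincol: "finite (f v)" if "v \<in> V" for v
    using col[OF that] finite_subset by blast
  have "sym r" "irrefl r"
    using arcs_symmetric no_loops' by (auto simp: r_def intro!: symI irreflI)
  moreover have "\<exists>u\<in>X. (v, u) \<in> r" if "v \<in> X" for v
    using that \<open>sym r\<close> by (auto simp: X_def dest: symD)
  ultimately obtain T where T: "T \<subseteq> X" "2 * card T \<le> card X"
    "\<And>v. v \<in> X - T \<Longrightarrow> \<exists>u\<in>T. (v, u) \<in> r"
    using Ore_half_dominating[OF finX] by metis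
  have TS: "T \<subseteq> S"
    using T(1) by (auto simp: X_def)
  have finT: "finite T"
    using TS finS finite_subset by blast
  have "card X \<le> card S"
    using finS by (auto simp: X_def intro: card_mono)
  with T(2) have cardT: "2 * card T \<le> card S"
    by simp
  \<comment> \<open>Leaving out \<open>T\<close> keeps the total size of these classes within
    \<open>card S - card T\<close>.\<close>
  define C where "C = (\<lambda>i. {v \<in> S - T. f v = {i}})"
  have gamma_le: "domination_number G \<le> card B + card T + card (C i)" if i: "i \<in> {1..k}" for i
  proof -
    have "dominating_set G (B \<union> T \<union> C i)"
      unfolding dominating_set_def
    proof (intro conjI ballI)
      show "B \<union> T \<union> C i \<subseteq> pverts G"
        using TS by (auto simp: B_def S_def C_def V_def)
      fix v assume "v \<in> pverts G - (B \<union> T \<union> C i)"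
      then have v: "v \<in> V" "v \<notin> B" "v \<notin> T" "v \<notin> C i"
        by (auto simp: V_def)
      have multi: "u \<in> S \<and> f u = {j} \<or> u \<in> B" if "u \<in> nbhd G v" "j \<in> f u" for u j
      proof -
        have u: "u \<in> V"
          using that by (auto simp: nbhd_def V_def dest: in_arcsD2)
        have "card (f u) \<noteq> 0"
          using fincol[OF u] that by auto
        then consider "card (f u) = 1" | "card (f u) \<ge> 2"
          by linarith
        then show ?thesis
          using u that(2) by cases (auto simp: S_def B_def card_1_singleton_iff)
      qed
      show "nbhd G v \<inter> (B \<union> T \<union> C i) \<noteq> {}"
      proof (cases "f v = {}")
        case True
        then have "(\<Union>u\<in>nbhd G v. f u) = {1..k}"
          using f v(1) by (simp add: k_rtdf_def V_def)
        with i obtain u where "u \<in> nbhd G v" "i \<in> f u"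
          by blast
        \<comment> \<open>The neighbor \<open>u\<close> lies in \<open>B\<close>, or it has the
          color set \<open>{i}\<close> and so lies in \<open>T\<close> or
          \<open>C i\<close>.\<close>
        with multi[of u i] show ?thesis
          by (auto simp: C_def)
      next
        case False
        with v have vS: "v \<in> S"
          using fincol[OF v(1)] card_gt_0_iff[of "f v"] by (auto simp: S_def B_def)
        then obtain j where j: "f v = {j}"
          by (auto simp: S_def card_1_singleton_iff)
        moreover from j have "j \<in> {1..k}"
          using col[OF v(1)] by auto
        ultimately obtain u where u: "u \<in> nbhd G v" "j \<in> f u"
          using f v(1) unfolding k_rtdf_def V_def by blast
        \<comment> \<open>The color \<open>j\<close> of \<open>v\<close> may differ from
          \<open>i\<close>, so \<open>C i\<close> is of no help here: either \<open>u\<close> is in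
          \<open>B\<close>, or \<open>v\<close> is in \<open>X\<close> and \<open>T\<close>
          dominates it.\<close>
        from multi[OF this] show ?thesis
        proof
          assume "u \<in> S \<and> f u = {j}"
          with u j vS have "v \<in> X"
            by (auto simp: X_def r_def nbhd_def)
          with T(3)[of v] v show ?thesis
            by (auto simp: r_def nbhd_def)
        qed (use u in auto)
      qed
    qed
    then have "domination_number G \<le> card (B \<union> T \<union> C i)"
      by (rule domination_number_le)
    also have "\<dots> \<le> card (B \<union> T) + card (C i)"
      by (rule card_Un_le)
    also have "\<dots> \<le> card B + card T + card (C i)"
      by (simp add: card_Un_le)
    finally show ?thesis .
  qed
  have "(\<Sum>i\<in>{1..k}. card (C i)) = card (\<Union>i\<in>{1..k}. C i)"
    using finS by (intro card_UN_disjoint[symmetric]) (auto simp: C_def)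
  also have "\<dots> \<le> card (S - T)"
    using finS by (intro card_mono) (auto simp: C_def)
  finally have sumC: "(\<Sum>i\<in>{1..k}. card (C i)) \<le> card S - card T"
    using card_Diff_subset[OF finT TS] by simp
  have "k * domination_number G \<le> (\<Sum>i\<in>{1..k}. card B + card T + card (C i))"
    using sum_mono[of "{1..k}" "\<lambda>_. domination_number G", OF gamma_le] by simp
  also have "\<dots> \<le> k * (card B + card T) + (card S - card T)"
    using sumC by (simp add: sum.distrib algebra_simps)
  finally have gamma: "k * domination_number G \<le> k * (card B + card T) + (card S - card T)" .
  have "card S + 2 * card B \<le> (\<Sum>v\<in>S. card (f v)) + (\<Sum>v\<in>B. card (f v))"
    using sum_mono[of B "\<lambda>_. 2" "\<lambda>v. card (f v)"] by (simp add: S_def B_def)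
  also have "\<dots> = (\<Sum>v\<in>S \<union> B. card (f v))"
    using finS finB by (intro sum.union_disjoint[symmetric]) (auto simp: S_def B_def)
  also have "\<dots> \<le> weight G f"
    using finV unfolding weight_def V_def[symmetric]
    by (intro sum_mono2) (auto simp: S_def B_def)
  finally have w: "card S + 2 * card B \<le> weight G f" .
  \<comment> \<open>The slack \<open>d\<close> replaces the truncated difference:
    \<open>card S - card T = card T + d\<close>. In the second inequality below, the right side then
    exceeds the left by \<open>(k - 1) * d + 2 * card B\<close>.\<close>
  obtain d where d: "card S = 2 * card T + d"
    using cardT le_Suc_ex by blast
  have "2 * k * domination_number G \<le> 2 * (k * (card B + card T) + (card T + d))"
    using gamma d by simp
  also have "\<dots> \<le> (k + 1) * (card S + 2 * card B)"
  proof -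
    have "d \<le> d * k"
      using \<open>k \<ge> 1\<close> by simp
    then show ?thesis
      unfolding d by (simp add: algebra_simps trans_le_add1 del: mult_le_cancel1 n_less_n_mult_m)
  qed
  also have "\<dots> \<le> (k + 1) * weight G f"
    using w by (rule mult_le_mono2)
  finally show ?thesis .
qed

theorem theorem10:
  fixes G :: "'a pair_pre_digraph" and k :: nat
  assumes "pair_graph G" and "k \<ge> 2"
  shows "real (k_rt_domination_number k G) \<ge> 2 * real k / (real k + 1) * real (domination_number G)"
proof -
  obtain f where "k_rtdf k G f" "weight G f = k_rt_domination_number k G"
    using k_rt_domination_number_attained[OF assms(2)] .
  then have "2 * k * domination_number G \<le> (k + 1) * k_rt_domination_number k G"
    using k_rtdf_weight_bound[OF assms(1), of k] assms(2) by (metis One_nat_def Suc_leD numeral_2_eq_2)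
  then have "real (2 * k * domination_number G) \<le> real ((k + 1) * k_rt_domination_number k G)"
    by (rule of_nat_mono)
  then show ?thesis
    by (simp add: field_simps)
qed

end
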